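(* A binary sequence $r_0r_1\cdots r_n$ is the ppr-sequence of some $n\times n$ nonnegative symmetric real matrix if and only if one of the following holds: (1) $r_0=0$ and $r_i=1$ for $i=1,2,\dots,n$; or (2) there are nonnegative integers $\ell,k,m$ with $\ell\le k\le m\le \ell+k+1$ such that (a) $r_{2j+1}=0$ for every $j<\ell$; (b) $r_{2j+1}=1$ for every $j$ with $\ell\le j\le k$; (c) $r_{2j+1}=0$ for every $j$ with $k<j\le\frac{n-1}{2}$; (d) $r_{2j}=1$ for every $j$ with $0\le j\le m$; and (e) $r_{2j}=0$ for every $j$ with $m<j\le \frac{n}{2}$ (here $2k+1\le n$ and $2m\le n$, so all indices referred to lie in $\{0,\dots,n\}$); or (3) $r_0=1$, $r_i=0$ for all odd $i\le n$, $r_i=1$ for all even $i\le 2m$, and $r_i=0$ for all even $i$ with $2m<i\le n$, for some nonnegative integer $m\le\lfloor \frac{n}{2}\rfloor$.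
   Context: The permanent of an $p\times p$ matrix is ${\rm per}(A)=\sum_{\sigma\in S_p}\prod_{i=1}^p a_{i\sigma(i)}$. The principal permanent rank characteristic sequence (ppr-sequence) of an $n\times n$ matrix $A$ is $r_0r_1\cdots r_n$ where, for $1\le k\le n$, $r_k=1$ iff $A$ has a principal submatrix of size $k$ with nonzero permanent (else $r_k=0$), and $r_0=1$ iff $A$ has a zero entry on its main diagonal.
   Formalization: The formal theorem assumes n ≥ 2; the claim fails for n = 1 (11 satisfies (2) with ℓ = k = m = 0, but no 1×1 matrix attains it) and for n = 0 (r_0 = 1 satisfies (3), but the empty matrix has no zero diagonal entry). *)

theory Defs
  imports Complex_Main "Jordan_Normal_Form.Matrix" "Jordan_Normal_Form.DL_Submatrix"
    "HOL-Combinatorics.Permutations"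
begin

text \<open>The sum makes sense for square matrices only; it is never applied to any other matrix below.\<close>

definition permanent :: "'a::comm_semiring_1 mat \<Rightarrow> 'a" where
  "permanent A = (\<Sum>p | p permutes {0..<dim_row A}. \<Prod>i = 0..<dim_row A. A $$ (i, p i))"

text \<open>The term at index \<open>0\<close> does not refer to principal submatrices: it records
  whether some diagonal entry vanishes.\<close>

definition ppr :: "'a::comm_semiring_1 mat \<Rightarrow> nat \<Rightarrow> nat" where
  "ppr A k =
    (if k = 0 then (if \<exists>i<dim_row A. A $$ (i, i) = 0 then 1 else 0)
     else (if \<exists>I. I \<subseteq> {0..<dim_row A} \<and> card I = k \<and> permanent (submatrix A I I) \<noteq> 0
           then 1 else 0))"

definition ppr_sequence :: "'a::comm_semiring_1 mat \<Rightarrow> nat list" where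
  "ppr_sequence A = map (ppr A) [0..<Suc (dim_row A)]"

end

theory Submission
  imports Defs "HOL-Combinatorics.Cycles"
begin

text \<open>
  The nonzero pattern of a symmetric nonnegative matrix is a graph with loops, and a principal
  submatrix has nonzero permanent iff its vertices carry a permutation along edges. Even cycles of
  such a permutation split into edges and an odd cycle becomes a matching after deleting a vertex,
  so the even cover sizes are closed under subtracting 2 and only a cover that is a single odd
  cycle \<open>x\<close> could leave a gap among the odd sizes. If a shorter odd cycle \<open>y\<close> exists, then either an
  ear of \<open>y\<close> on \<open>x\<close> is shorter than the arc of the same parity, and rerouting \<open>x\<close> through it fills
  the gap, or \<open>y\<close> can be pushed into \<open>x\<close> without getting longer, although \<open>x\<close> contains no shorter odd
  closed walk.
  The bound on \<open>m\<close> holds because an odd cycle of length \<open>2 * l + 1\<close> meets at most that many edges of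
  a matching. Conversely, an odd cycle with pendant edges at consecutive vertices and some isolated
  edges realizes every sequence of the second kind.
\<close>

subsection \<open>Covers of looped graphs\<close>

locale looped_graph =
  fixes E :: "'a \<Rightarrow> 'a \<Rightarrow> bool"
  assumes E_sym: "E a b \<Longrightarrow> E b a"
begin

text \<open>A fixed point of \<open>p\<close> uses a loop and a 2-cycle of \<open>p\<close> uses an
  edge, so these are the sets covered by disjoint loops, edges and cycles.\<close>

definition coverable :: "'a set \<Rightarrow> bool" where
  "coverable I \<longleftrightarrow> finite I \<and> (\<exists>p. bij_betw p I I \<and> (\<forall>i\<in>I. E i (p i)))"

text \<open>Only the vertex set of a matching is recorded, since only its size and its disjointness
  from other sets matter.\<close>

inductive matched :: "'a set \<Rightarrow> bool" where
  matched_empty: "matched {}"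
| matched_pair: "E a b \<Longrightarrow> a \<noteq> b \<Longrightarrow> a \<notin> S \<Longrightarrow> b \<notin> S \<Longrightarrow> matched S \<Longrightarrow> matched (insert a (insert b S))"

text \<open>A cycle of length \<open>n\<close> is given by an \<open>n\<close>-periodic map on the
  integers, its universal cover, so that arcs, shifts and reversal need no modular reduction. Length
  1 is a loop and length 2 a single edge.\<close>

definition cyclic :: "(int \<Rightarrow> 'a) \<Rightarrow> nat \<Rightarrow> bool" where
  "cyclic g n \<longleftrightarrow> n \<ge> 1 \<and> (\<forall>a b. g a = g b \<longleftrightarrow> int n dvd a - b) \<and> (\<forall>a. E (g a) (g (a + 1)))"

lemma coverable_empty: "coverable {}"
  by (simp add: coverable_def bij_betw_def)

lemma coverable_finite: "coverable I \<Longrightarrow> finite I"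
  by (simp add: coverable_def)

lemma coverable_Un:
  assumes "coverable I" "coverable J" "I \<inter> J = {}"
  shows "coverable (I \<union> J)"
proof -
  obtain p where p: "finite I" "bij_betw p I I" "\<And>i. i \<in> I \<Longrightarrow> E i (p i)"
    using assms(1) unfolding coverable_def by blast
  obtain q where q: "finite J" "bij_betw q J J" "\<And>i. i \<in> J \<Longrightarrow> E i (q i)"
    using assms(2) unfolding coverable_def by blast
  have "bij_betw (\<lambda>x. if x \<in> I then p x else q x) (I \<union> J) (I \<union> J)"
    by (rule bij_betw_disjoint_Un) (use p q assms(3) in auto)
  with p q show ?thesis
    unfolding coverable_def by (intro conjI exI[of _ "\<lambda>x. if x \<in> I then p x else q x"]) auto
qed

lemma coverable_edge: "E a b \<Longrightarrow> coverable {a, b}"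
  unfolding coverable_def
  by (intro conjI exI[of _ "\<lambda>x. if x = a then b else a"]) (auto simp: bij_betw_def inj_on_def E_sym)

section \<open>Matchings\<close>

lemma matched_finite: "matched S \<Longrightarrow> finite S"
  by (induction rule: matched.induct) auto

lemma matched_even: "matched S \<Longrightarrow> even (card S)"
  by (induction rule: matched.induct) (auto simp: matched_finite)

lemma matched_Un: "matched S \<Longrightarrow> matched T \<Longrightarrow> S \<inter> T = {} \<Longrightarrow> matched (S \<union> T)"
  by (induction rule: matched.induct) (auto intro!: matched_pair)

lemma matched_coverable: "matched S \<Longrightarrow> coverable S"
proof (induction rule: matched.induct)
  case (matched_pair a b S)
  then have "coverable ({a, b} \<union> S)"
    by (intro coverable_Un coverable_edge) auto
  then show ?case by simp
qed (rule coverable_empty)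

lemma matched_subset:
  assumes "matched S" "2 * i \<le> card S"
  shows "\<exists>T\<subseteq>S. matched T \<and> card T = 2 * i"
  using assms
proof (induction arbitrary: i rule: matched.induct)
  case matched_empty
  then show ?case by (auto intro: matched.intros)
next
  case (matched_pair a b S)
  show ?case
  proof (cases i)
    case 0
    then show ?thesis by (auto intro!: exI[of _ "{}"] matched.intros)
  next
    case (Suc i')
    then have "2 * i' \<le> card S"
      using matched_pair matched_finite[of S] by simp
    then obtain T where T: "T \<subseteq> S" "matched T" "card T = 2 * i'"
      using matched_pair.IH by blast
    moreover have "a \<notin> T" "b \<notin> T" using matched_pair.hyps T(1) by auto
    ultimately have "matched (insert a (insert b T))" "card (insert a (insert b T)) = 2 * i"
      using matched_pair.hyps Suc matched_finite[of T]
      by (auto intro!: matched.matched_pair)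
    then show ?thesis using T(1) by (intro exI[of _ "insert a (insert b T)"]) auto
  qed
qed

text \<open>Each vertex of \<open>C\<close> spoils at most one edge of the matching.\<close>

lemma matched_avoid:
  assumes "matched S" "finite C"
  shows "\<exists>T\<subseteq>S - C. matched T \<and> card S \<le> card T + 2 * card (S \<inter> C)"
  using assms(1)
proof (induction rule: matched.induct)
  case matched_empty
  then show ?case by (auto intro: matched.intros)
next
  case (matched_pair a b S)
  obtain T where T: "T \<subseteq> S - C" "matched T" "card S \<le> card T + 2 * card (S \<inter> C)"
    using matched_pair.IH by blast
  have fin: "finite S" "finite T" using matched_pair T by (auto simp: matched_finite)
  show ?case
  proof (cases "a \<in> C \<or> b \<in> C")
    case True
    have "card (S \<inter> C) < card (insert a (insert b S) \<inter> C)"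
      using True matched_pair fin by (intro psubset_card_mono) auto
    then show ?thesis using T fin matched_pair.hyps by (intro exI[of _ T]) auto
  next
    case False
    have "a \<notin> T" "b \<notin> T" using matched_pair.hyps T(1) by auto
    then have "matched (insert a (insert b T))" "insert a (insert b S) \<inter> C = S \<inter> C"
      "card (insert a (insert b T)) = card T + 2"
      using matched_pair.hyps False T fin by (auto intro!: matched.matched_pair)
    moreover have "card (insert a (insert b S)) = card S + 2"
      using matched_pair.hyps fin by auto
    ultimately show ?thesis
      using T False by (intro exI[of _ "insert a (insert b T)"]) auto
  qed
qed

text \<open>Only the edges from even to odd positions are asked for, so \<open>h\<close> may also
  list disjoint pairs that form no path.\<close>

lemma matched_path:
  fixes h :: "nat \<Rightarrow> 'a"
  assumes "inj_on h {..<2 * i}" "\<And>q. q < i \<Longrightarrow> E (h (2 * q)) (h (2 * q + 1))"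
  shows "matched (h ` {..<2 * i})"
  using assms
proof (induction i)
  case (Suc i)
  have "matched (h ` {..<2 * i})"
    using Suc.prems by (intro Suc.IH) (auto intro: inj_on_subset)
  moreover have "h ` {..<2 * Suc i} = insert (h (2 * i)) (insert (h (2 * i + 1)) (h ` {..<2 * i}))"
    by (auto simp: lessThan_Suc)
  moreover have "h (2 * i) \<noteq> h (2 * i + 1)"
    using inj_onD[OF Suc.prems(1), of "2 * i" "2 * i + 1"] by auto
  moreover have "h (2 * i) \<notin> h ` {..<2 * i}" "h (2 * i + 1) \<notin> h ` {..<2 * i}"
    using inj_onD[OF Suc.prems(1)] by fastforce+
  ultimately show ?case
    using Suc.prems(2)[of i] by (auto intro: matched_pair)
qed (simp add: matched_empty)

section \<open>Cycles as periodic maps\<close>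

lemma cyclic_eq_iff: "cyclic g n \<Longrightarrow> g a = g b \<longleftrightarrow> int n dvd a - b"
  and cyclic_edge: "cyclic g n \<Longrightarrow> E (g a) (g (a + 1))"
  and cyclic_pos: "cyclic g n \<Longrightarrow> n \<ge> 1"
  by (simp_all add: cyclic_def)

lemma cyclic_shift: "cyclic g n \<Longrightarrow> cyclic (\<lambda>i. g (i + c)) n"
  unfolding cyclic_def by (auto simp: add.assoc add.commute[of 1]) (metis add.assoc add.commute)+

lemma cyclic_reverse: "cyclic g n \<Longrightarrow> cyclic (\<lambda>i. g (- i)) n"
  unfolding cyclic_def
proof (intro conjI allI; (elim conjE)?)
  fix a assume *: "\<forall>a. E (g a) (g (a + 1))"
  show "E (g (- a)) (g (- (a + 1)))"
    using *[rule_format, of "- (a + 1)"] by (simp add: E_sym)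
qed (auto simp: dvd_diff_commute)

lemma cyclic_inj:
  assumes "cyclic g n" "\<And>a b. a \<in> A \<Longrightarrow> b \<in> A \<Longrightarrow> \<bar>a - b\<bar> < int n"
  shows "inj_on g A"
proof (rule inj_onI)
  fix a b assume "a \<in> A" "b \<in> A" "g a = g b"
  then show "a = b"
    using assms by (metis cyclic_eq_iff dvd_imp_le_int eq_iff_diff_eq_0 not_le abs_of_nat)
qed

lemma cyclic_mod: "cyclic g n \<Longrightarrow> g (a mod int n) = g a"
  by (subst cyclic_eq_iff, assumption) (simp add: mod_eq_dvd_iff[symmetric])

lemma cyclic_range: 
  assumes "cyclic g n"
  shows "range g = (\<lambda>i. g (int i)) ` {..<n}" "inj_on (\<lambda>i. g (int i)) {..<n}"
proof -
  have "g a \<in> (\<lambda>i. g (int i)) ` {..<n}" for a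
  proof
    show "g a = g (int (nat (a mod int n)))"
      using cyclic_mod[OF assms, of a] cyclic_pos[OF assms] by simp
    show "nat (a mod int n) \<in> {..<n}"
      using cyclic_pos[OF assms] by (auto simp: nat_less_iff)
  qed
  then show "range g = (\<lambda>i. g (int i)) ` {..<n}" by auto
  have "inj_on g (int ` {..<n})" by (rule cyclic_inj[OF assms]) auto
  then show "inj_on (\<lambda>i. g (int i)) {..<n}"
    by (simp add: inj_on_def)
qed

lemma cyclic_card: "cyclic g n \<Longrightarrow> card (range g) = n"
  by (simp add: cyclic_range card_image)

lemma cyclic_finite: "cyclic g n \<Longrightarrow> finite (range g)"
  by (simp add: cyclic_range)

lemma cyclic_coverable:
  assumes "cyclic g n"
  shows "coverable (range g)"
proof -
  \<comment> \<open>Any preimage of \<open>v\<close> serves, because \<open>g a = g b\<close>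
    implies \<open>g (a + 1) = g (b + 1)\<close>.\<close>
  define s where "s v = g ((SOME a. g a = v) + 1)" for v
  have s: "s (g a) = g (a + 1)" for a
  proof -
    have "g (SOME b. g b = g a) = g a" by (rule someI) simp
    then show ?thesis
      using assms by (simp add: s_def cyclic_eq_iff)
  qed
  have "inj_on s (range g)"
    by (rule inj_onI) (use assms in \<open>auto simp: s cyclic_eq_iff\<close>)
  moreover have "s ` range g = range g"
    by (auto simp: s image_iff) (metis diff_add_cancel)
  ultimately show ?thesis
    unfolding coverable_def using cyclic_finite[OF assms] cyclic_edge[OF assms]
    by (intro conjI exI[of _ s]) (auto simp: bij_betw_def s)
qed

text \<open>A closed walk with distinct vertices becomes periodic by reducing the position modulo
  \<open>n\<close>.\<close>

lemma cyclic_of_path: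
  assumes "n \<ge> 1" "inj_on h {..<n}" "\<And>i. i < n \<Longrightarrow> E (h i) (h (Suc i))" "h n = h 0"
  shows "\<exists>g. cyclic g n \<and> range g = h ` {..<n}"
proof -
  define g where "g a = h (nat (a mod int n))" for a
  have lt: "nat (a mod int n) < n" for a using assms(1) by (auto simp: nat_less_iff)
  have "g a = g b \<longleftrightarrow> int n dvd a - b" for a b
  proof -
    have "g a = g b \<longleftrightarrow> nat (a mod int n) = nat (b mod int n)"
      unfolding g_def using assms(2) lt by (auto simp: inj_on_eq_iff)
    also have "\<dots> \<longleftrightarrow> a mod int n = b mod int n"
      using assms(1) by (auto simp: eq_nat_nat_iff)
    finally show ?thesis by (simp add: mod_eq_dvd_iff)
  qed
  moreover have "E (g a) (g (a + 1))" for a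
  proof -
    have "g (a + 1) = h (Suc (nat (a mod int n)))"
    proof (cases "a mod int n + 1 = int n")
      \<comment> \<open>At the last position the step wraps around to 0, which is where
        \<open>h n = h 0\<close> enters.\<close>
      case True
      then have "(a + 1) mod int n = 0" by (metis mod_add_left_eq mod_self)
      moreover have "Suc (nat (a mod int n)) = n" using True assms(1) by linarith
      ultimately show ?thesis using assms(4) by (simp add: g_def)
    next
      case False
      have "a mod int n < int n" "0 \<le> a mod int n" using assms(1) by auto
      then have "(a + 1) mod int n = a mod int n + 1"
        using False by (metis mod_add_left_eq mod_pos_pos_trivial zless_imp_add1_zle order_le_less add_nonneg_nonneg zero_le_one)
      then show ?thesis using \<open>0 \<le> a mod int n\<close> by (simp add: g_def nat_add_distrib)
    qed
    then show ?thesis using assms(3)[OF lt] by (simp add: g_def)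
  qed
  ultimately have "cyclic g n" using assms(1) by (simp add: cyclic_def)
  moreover have "range g = h ` {..<n}"
  proof
    show "range g \<subseteq> h ` {..<n}" using lt by (auto simp: g_def)
    have "h i = g (int i)" if "i < n" for i using that by (simp add: g_def)
    then show "h ` {..<n} \<subseteq> range g" by auto
  qed
  ultimately show ?thesis by blast
qed

lemma cyclic_arc_matched:
  assumes "cyclic g n" "2 * i \<le> n"
  shows "matched ((\<lambda>t. g (c + int t)) ` {..<2 * i})" "card ((\<lambda>t. g (c + int t)) ` {..<2 * i}) = 2 * i"
proof -
  have inj: "inj_on (\<lambda>t. g (c + int t)) {..<2 * i}"
  proof -
    have "inj_on g ((\<lambda>t. c + int t) ` {..<2 * i})"
      by (rule cyclic_inj[OF assms(1)]) (use assms(2) in auto)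
    then show ?thesis by (auto simp: inj_on_def)
  qed
  show "matched ((\<lambda>t. g (c + int t)) ` {..<2 * i})"
    by (rule matched_path[OF inj]) (metis add.assoc assms(1) cyclic_edge of_nat_1 of_nat_add)
  show "card ((\<lambda>t. g (c + int t)) ` {..<2 * i}) = 2 * i"
    using inj by (simp add: card_image)
qed

section \<open>Splitting covers into cycles\<close>

text \<open>The orbit of \<open>x\<close> under the covering permutation is the cycle, and the
  permutation restricts to the complement of that orbit.\<close>

lemma coverable_split_cycle:
  assumes "coverable X" "x \<in> X"
  shows "\<exists>g n. cyclic g n \<and> range g \<subseteq> X \<and> coverable (X - range g)"
proof -
  obtain p where p: "finite X" "bij_betw p X X" "\<And>i. i \<in> X \<Longrightarrow> E i (p i)"
    using assms(1) unfolding coverable_def by blast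
  \<comment> \<open>Fixing everything outside \<open>X\<close> makes \<open>q\<close> a permutation
    of the whole type, with \<open>least_power\<close> as the orbit length.\<close>
  define q where "q i = (if i \<in> X then p i else i)" for i
  have bq: "bij_betw q X X" using p(2) by (simp add: q_def cong: bij_betw_cong)
  then have perm: "q permutes X"
    by (rule bij_imp_permutes) (simp add: q_def)
  then have q: "permutation q" using p(1) by (auto simp: permutation_permutes)
  define n where "n = least_power q x"
  define h where "h i = (q ^^ i) x" for i
  have n: "n > 0" "h n = h 0"
    using least_power_of_permutation[OF q, of x] by (auto simp: n_def h_def)
  have "distinct (map h [0..<n])"
    using cycle_of_permutation[OF q, of x] by (simp add: h_def[abs_def] n_def)
  then have inj: "inj_on h {..<n}"
    by (simp add: distinct_map atLeast0LessThan)
  have inX: "h i \<in> X" for i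
    by (induction i) (use assms(2) bq in \<open>auto simp: h_def bij_betw_def\<close>)
  have hS: "h (Suc i) = q (h i)" for i by (simp add: h_def)
  have "\<exists>g. cyclic g n \<and> range g = h ` {..<n}"
    using n inj p(3) inX hS by (intro cyclic_of_path) (auto simp: q_def)
  then obtain g where g: "cyclic g n" "range g = h ` {..<n}" by blast
  have "q ` (h ` {..<n}) = h ` {..<n}"
  proof -
    have "q ` (h ` {..<n}) = h ` (Suc ` {..<n})" by (simp add: image_image hS)
    also have "Suc ` {..<n} = {1..<n} \<union> {n}"
      using n by (auto simp: image_Suc_lessThan)
    also have "h ` \<dots> = h ` {1..<n} \<union> {h 0}" using n by auto
    also have "\<dots> = h ` ({1..<n} \<union> {0})" by auto
    also have "{1..<n} \<union> {0} = {..<n}" using n by auto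
    finally show ?thesis .
  qed
  then have "bij_betw q (h ` {..<n}) (h ` {..<n})"
    using inX by (intro bij_betw_subset[OF bq]) auto
  then have "bij_betw q (X - h ` {..<n}) (X - h ` {..<n})"
    using bq inX by (intro bij_betw_DiffI) auto
  then have "coverable (X - h ` {..<n})"
    unfolding coverable_def using p by (intro conjI exI[of _ q]) (auto simp: q_def)
  then show ?thesis using g inX by (intro exI[of _ g] exI[of _ n]) auto
qed

text \<open>Cycles are split off one at a time. An even one is matched by every other edge and set
  aside; the first odd one ends the recursion, and the even ones return to its complement.\<close>

lemma coverable_matched_or_odd_cycle:
  assumes "coverable X"
  shows "matched X \<or> (\<exists>g n. odd n \<and> cyclic g n \<and> range g \<subseteq> X \<and> coverable (X - range g))"
  using coverable_finite[OF assms] assms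
proof (induction X rule: finite_psubset_induct)
  case (psubset X)
  show ?case
  proof (cases "X = {}")
    case True
    then show ?thesis by (simp add: matched_empty)
  next
    case False
    then obtain g n where g: "cyclic g n" "range g \<subseteq> X" "coverable (X - range g)"
      using coverable_split_cycle psubset.prems by blast
    show ?thesis
    proof (cases "odd n")
      case True
      then show ?thesis using g by blast
    next
      case even: False
      have eq: "(\<lambda>i. g (0 + int i)) ` {..<2 * (n div 2)} = range g"
        using even by (simp add: cyclic_range[OF g(1)])
      have mr: "matched (range g)"
        using cyclic_arc_matched(1)[OF g(1), of "n div 2" 0] unfolding eq by simp
      have "X - range g \<subset> X" using g(2) by blast
      from psubset.IH[OF this g(3)] show ?thesis
      proof (elim disjE exE conjE)
        assume "matched (X - range g)"
        then have "matched (X - range g \<union> range g)" using mr by (intro matched_Un) auto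
        then show ?thesis using g(2) by (simp add: Un_absorb2)
      next
        fix f c assume f: "odd c" "cyclic f c" "range f \<subseteq> X - range g" "coverable (X - range g - range f)"
        have "coverable ((X - range g - range f) \<union> range g)"
          using f g by (intro coverable_Un cyclic_coverable) auto
        moreover have "(X - range g - range f) \<union> range g = X - range f"
          using f(3) g(2) by auto
        ultimately show ?thesis using f by (intro disjI2 exI[of _ f] exI[of _ c]) auto
      qed
    qed
  qed
qed

section \<open>Shrinking covers\<close>

lemma odd_cycle_delete:
  assumes "cyclic g n" "odd n"
  shows "\<exists>T\<subseteq>range g. matched T \<and> card T + 1 = n"
  using cyclic_arc_matched[OF assms(1), of "n div 2" 0] assms(2)
  by (intro exI[of _ "(\<lambda>t. g (0 + int t)) ` {..<2 * (n div 2)}"]) auto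

lemma cyclic_card_Diff:
  assumes "cyclic g n" "range g \<subseteq> X" "coverable (X - range g)"
  shows "card X = card (X - range g) + n"
proof -
  have "finite X"
    using coverable_finite[OF assms(3)] cyclic_finite[OF assms(1)] by simp
  then show ?thesis
    using assms(2) card_Diff_subset[of "range g" X] card_mono[of X "range g"]
    by (simp add: cyclic_finite[OF assms(1)] cyclic_card[OF assms(1)])
qed

lemma coverable_replace_cycle:
  assumes "cyclic g n" "odd n" "range g \<subseteq> X" "coverable (X - range g)"
  shows "\<exists>Y\<subseteq>X. coverable Y \<and> card Y + 1 = card X"
proof -
  obtain T where T: "T \<subseteq> range g" "matched T" "card T + 1 = n"
    using odd_cycle_delete[OF assms(1,2)] by blast
  have fin: "finite (X - range g)" "finite (range g)" "finite T"
    using coverable_finite[OF assms(4)] cyclic_finite[OF assms(1)] matched_finite[OF T(2)] by blast+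
  have "coverable ((X - range g) \<union> T)"
    using T(1) by (intro coverable_Un assms(4) matched_coverable[OF T(2)]) auto
  moreover have "card ((X - range g) \<union> T) = card (X - range g) + card T"
    using fin T by (intro card_Un_disjoint) auto
  moreover have "card X = card (X - range g) + n"
    using cyclic_card_Diff[OF assms(1,3,4)] .
  ultimately show ?thesis
    using T assms by (intro exI[of _ "(X - range g) \<union> T"]) auto
qed

lemma coverable_pred_or_matched:
  assumes "coverable X"
  shows "matched X \<or> (\<exists>Y\<subseteq>X. coverable Y \<and> card Y + 1 = card X)"
  using coverable_matched_or_odd_cycle[OF assms]
proof (elim disjE exE conjE)
  fix g n assume "odd n" "cyclic g n" "range g \<subseteq> X" "coverable (X - range g)"
  then show ?thesis by (intro disjI2 coverable_replace_cycle[of g n])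
qed simp

lemma coverable_odd_pred:
  "coverable X \<Longrightarrow> odd (card X) \<Longrightarrow> \<exists>Y\<subseteq>X. coverable Y \<and> card Y + 1 = card X"
  using coverable_pred_or_matched[of X] matched_even[of X] by auto

text \<open>A matching loses an edge. Otherwise an odd cycle loses a vertex; what remains has odd
  size, hence again contains an odd cycle, which loses a second vertex.\<close>

lemma coverable_even_step:
  assumes "coverable X" "even (card X)" "X \<noteq> {}"
  shows "\<exists>Y\<subseteq>X. coverable Y \<and> card Y + 2 = card X"
  using coverable_pred_or_matched[OF assms(1)]
proof (elim disjE exE conjE)
  assume "matched X"
  moreover obtain i where i: "card X = 2 * i" using assms(2) by auto
  moreover have "i > 0" using assms i by (auto simp: card_eq_0_iff coverable_finite)
  ultimately obtain T where "T \<subseteq> X" "matched T" "card T = 2 * (i - 1)"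
    using matched_subset[of X "i - 1"] by auto
  then show ?thesis using i \<open>i > 0\<close> matched_coverable by (intro exI[of _ T]) auto
next
  fix Y assume Y: "Y \<subseteq> X" "coverable Y" "card Y + 1 = card X"
  then have "odd (card Y)" using assms(2) by presburger
  then obtain Z where "Z \<subseteq> Y" "coverable Z" "card Z + 1 = card Y"
    using coverable_odd_pred Y by blast
  then show ?thesis using Y by (intro exI[of _ Z]) auto
qed

lemma coverable_even_down:
  assumes "coverable X" "card X = 2 * m" "j \<le> m"
  shows "\<exists>Y\<subseteq>X. coverable Y \<and> card Y = 2 * j"
  using assms(3)
proof (induction j rule: inc_induct)
  case base
  then show ?case using assms by blast
next
  case (step j)
  then obtain Y where Y: "Y \<subseteq> X" "coverable Y" "card Y = 2 * Suc j" by blast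
  then obtain Z where "Z \<subseteq> Y" "coverable Z" "card Z + 2 = card Y"
    using coverable_even_step[of Y] by fastforce
  then show ?case using Y by (intro exI[of _ Z]) auto
qed

lemma coverable_odd_cycle:
  assumes "coverable X" "odd (card X)"
  obtains g n where "odd n" "cyclic g n" "range g \<subseteq> X" "coverable (X - range g)"
proof -
  have "\<not> matched X" using matched_even assms(2) by auto
  then obtain g n where "odd n" "cyclic g n" "range g \<subseteq> X" "coverable (X - range g)"
    using coverable_matched_or_odd_cycle[OF assms(1)] by (elim disjE exE conjE) auto
  then show thesis by (rule that)
qed

text \<open>One odd cycle is kept and the rest, a cover of even size, shrinks by 2. This fails only
  if the rest is empty.\<close>

lemma coverable_odd_step_or_cycle:
  assumes "coverable X" "odd (card X)"
  shows "(\<exists>Y. coverable Y \<and> card Y + 2 = card X) \<or> (\<exists>g. cyclic g (card X) \<and> range g = X)"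
proof -
  obtain g n where g: "odd n" "cyclic g n" "range g \<subseteq> X" "coverable (X - range g)"
    using coverable_odd_cycle[OF assms] .
  have fin: "finite (range g)" "finite (X - range g)"
    using cyclic_finite[OF g(2)] coverable_finite[OF g(4)] by blast+
  have c: "card X = card (X - range g) + n"
    using cyclic_card_Diff[OF g(2-4)] .
  show ?thesis
  proof (cases "X - range g = {}")
    case True
    then show ?thesis using g c by (auto intro!: exI[of _ g])
  next
    case False
    moreover have "even (card (X - range g))" using c g(1) assms(2) by auto
    ultimately obtain Y where Y: "Y \<subseteq> X - range g" "coverable Y" "card Y + 2 = card (X - range g)"
      using coverable_even_step[OF g(4)] by blast
    have "coverable (Y \<union> range g)"
      using Y g by (intro coverable_Un cyclic_coverable) auto
    moreover have "card (Y \<union> range g) + 2 = card X"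
    proof -
      have "Y \<inter> range g = {}" using Y(1) by auto
      from card_Un_disjoint[OF coverable_finite[OF Y(2)] fin(1) this] show ?thesis
        using Y(3) c cyclic_card[OF g(2)] by simp
    qed
    ultimately show ?thesis by blast
  qed
qed

section \<open>Ears and short odd cycles\<close>

text \<open>The cover consists of the cycle formed by the ear and the complement of the arc that \<open>d\<close> spans,
  together with a matching inside that arc.\<close>

lemma ear_coverable_forward:
  assumes x: "cyclic x n"
    and c: "c \<ge> 1"
    and ends: "y 0 = x a" "y c = x (a + d)"
    and avoid: "\<And>i. 0 < i \<Longrightarrow> i < c \<Longrightarrow> y i \<notin> range x"
    and inj: "inj_on y {0<..<c}"
    and edges: "\<And>i. i < c \<Longrightarrow> E (y i) (y (Suc i))"
    and d: "even (d - int c)" "int c < d" "d \<le> int n"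
  shows "\<exists>Y. coverable Y \<and> card Y + 2 = n"
proof -
  \<comment> \<open>The new cycle will have \<open>c + e\<close> vertices, where
    \<open>n = d + e\<close>. Hence \<open>i\<close> edges inside the arc, whose interior has
    \<open>d - 1\<close> vertices, bring the size to \<open>n - 2\<close>.\<close>
  obtain i where i: "d = int c + 2 + 2 * int i"
  proof -
    from d(1) obtain k where k: "d - int c = 2 * k" by (elim evenE)
    then have "d = int c + 2 + 2 * int (nat (k - 1))" using d(2) by auto
    then show thesis by (rule that)
  qed
  obtain e where e: "int n = d + int e" using d(3) by (metis zle_iff_zadd)
  \<comment> \<open>The walk follows the ear from \<open>x a\<close> to \<open>x (a + d)\<close> and
    then \<open>x\<close> itself for \<open>e\<close> more steps, up to
    \<open>x (a + n) = x a\<close>. For \<open>d = n\<close> the ear is closed and forms the cycle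
    alone.\<close>
  define h where "h j = (if j < c then y j else x (a + d + int (j - c)))" for j
  have xx: "x u \<noteq> x v" if "u < v" "v < u + int n" for u v
  proof
    assume "x u = x v"
    then have "int n dvd v - u" using cyclic_eq_iff[OF x, of v u] by simp
    then show False using that zdvd_imp_le[of "int n" "v - u"] by simp
  qed
  have h0: "h 0 = x a" using c ends by (simp add: h_def)
  have hy: "h j = y j" if "0 < j" "j < c" for j using that by (simp add: h_def)
  have hx: "h (c + s) = x (a + d + int s)" for s by (simp add: h_def)
  have split: "j = 0 \<or> (0 < j \<and> j < c) \<or> (\<exists>s<e. j = c + s)" if "j < c + e" for j
    using that by (cases "j < c") (auto intro: exI[of _ "j - c"])
  have "inj_on h {..<c + e}"
  proof (rule linorder_inj_onI)
    fix j k assume jk: "j < k" "j \<in> {..<c + e}" "k \<in> {..<c + e}"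
    show "h j \<noteq> h k"
    proof (cases "k < c")
      case True
      then have "h k = y k" using jk(1) by (intro hy) auto
      moreover have "h j \<noteq> y k"
      proof (cases "j = 0")
        case True
        then show ?thesis using avoid[of k] \<open>k < c\<close> jk(1) h0 by (metis gr0I not_less_zero rangeI)
      next
        case False
        then have "h j = y j" using jk(1) \<open>k < c\<close> by (intro hy) auto
        then show ?thesis
          using inj_onD[OF inj, of j k] jk(1) False \<open>k < c\<close> by auto
      qed
      ultimately show ?thesis by simp
    next
      case False
      define t where "t = k - c"
      have t: "k = c + t" "t < e" using False jk by (auto simp: t_def)
      have "j = 0 \<or> (0 < j \<and> j < c) \<or> (\<exists>s<e. j = c + s)"
        using split[of j] jk by auto
      then have "h j \<noteq> x (a + d + int t)"
      proof (elim disjE conjE exE)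
        assume "j = 0"
        then show ?thesis using xx[of a "a + d + int t"] h0 e i t by auto
      next
        assume "0 < j" "j < c"
        then show ?thesis using avoid[of j] hy[of j] by (metis rangeI)
      next
        fix s assume "s < e" "j = c + s"
        then show ?thesis using xx[of "a + d + int s" "a + d + int t"] hx jk(1) t e i by auto
      qed
      then show ?thesis using t hx by simp
    qed
  qed auto
  moreover have "h (c + e) = h 0"
    unfolding h0 hx by (simp add: cyclic_eq_iff[OF x] e[symmetric] add.assoc)
  moreover have "E (h j) (h (Suc j))" if "j < c + e" for j
  proof -
    consider "Suc j < c" | "Suc j = c" | "c \<le> j" by linarith
    then show ?thesis
    proof cases
      case 1
      then show ?thesis using edges[of j] by (simp add: h_def)
    next
      case 2
      then show ?thesis using edges[of j] ends hx[of 0] by (simp add: h_def)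
    next
      case 3
      then obtain s where "j = c + s" by (metis le_Suc_ex)
      then show ?thesis
        using cyclic_edge[OF x, of "a + d + int s"] hx[of s] hx[of "Suc s"] by (simp add: ac_simps)
    qed
  qed
  ultimately obtain f where f: "cyclic f (c + e)" "range f = h ` {..<c + e}"
    using cyclic_of_path[of "c + e" h] c by auto
  define P where "P = (\<lambda>t. x (a + 1 + int t)) ` {..<2 * i}"
  have P: "matched P" "card P = 2 * i"
    unfolding P_def using cyclic_arc_matched[OF x, of i "a + 1"] i e by auto
  have "range f \<inter> P = {}"
  proof -
    have "h j \<noteq> x (a + 1 + int t)" if "j < c + e" "t < 2 * i" for j t
      using split[OF that(1)]
    proof (elim disjE conjE exE)
      assume "j = 0"
      then show ?thesis using xx[of a "a + 1 + int t"] that(2) h0 i e by auto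
    next
      assume "0 < j" "j < c"
      then show ?thesis using avoid[of j] hy[of j] by (metis rangeI)
    next
      fix s assume "s < e" "j = c + s"
      then show ?thesis using xx[of "a + 1 + int t" "a + d + int s"] that(2) hx i e by auto
    qed
    then show ?thesis unfolding f(2) P_def by auto
  qed
  then have "coverable (range f \<union> P)" "card (range f \<union> P) = c + e + 2 * i"
    using coverable_Un[OF cyclic_coverable[OF f(1)] matched_coverable[OF P(1)]]
      card_Un_disjoint[OF cyclic_finite[OF f(1)] matched_finite[OF P(1)]] P(2) cyclic_card[OF f(1)]
    by simp_all
  then show ?thesis using i e by (intro exI[of _ "range f \<union> P"]) auto
qed

text \<open>For negative \<open>d\<close> the cycle \<open>x\<close> is traversed backwards.\<close>

lemma ear_coverable:
  assumes x: "cyclic x n"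
    and c: "c \<ge> 1"
    and ends: "y 0 = x a" "y c = x (a + d)"
    and avoid: "\<And>i. 0 < i \<Longrightarrow> i < c \<Longrightarrow> y i \<notin> range x"
    and inj: "inj_on y {0<..<c}"
    and edges: "\<And>i. i < c \<Longrightarrow> E (y i) (y (Suc i))"
    and d: "even (d - int c)" "int c < \<bar>d\<bar>" "\<bar>d\<bar> \<le> int n"
  shows "\<exists>Y. coverable Y \<and> card Y + 2 = n"
proof (cases "d \<ge> 0")
  case True
  then show ?thesis
    using d by (intro ear_coverable_forward[OF x c ends avoid inj edges]) auto
next
  case False
  show ?thesis
  proof (rule ear_coverable_forward[where x = "\<lambda>i. x (- i)" and y = y and c = c and a = "- a" and d = "- d"])
    show "cyclic (\<lambda>i. x (- i)) n" by (rule cyclic_reverse[OF x])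
    show "y i \<notin> range (\<lambda>i. x (- i))" if "0 < i" "i < c" for i using avoid[OF that] by auto
  qed (use c ends inj edges d False in \<open>auto simp: add.commute\<close>)
qed

text \<open>If no cover of size \<open>n - 2\<close> exists, every ear of \<open>y\<close> on \<open>x\<close> is at least as long as the arc of \<open>x\<close>
  of the same parity. Following \<open>y\<close> therefore lifts to positions on the universal cover of \<open>x\<close>
  that move by at most as much as, and with the parity of, the time elapsed.
  After one turn the position is an odd multiple of \<open>n\<close>, which a shorter cycle cannot reach.\<close>

lemma short_odd_cycle_imp_coverable:
  assumes x: "cyclic x n" "odd n" and y: "cyclic y N" "odd N" and "N < n"
  shows "\<exists>Y. coverable Y \<and> card Y + 2 = n"
proof (cases "range y \<inter> range x = {}")
  case True
  \<comment> \<open>Disjoint cycles: \<open>y\<close> together with \<open>i\<close> edges of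
    \<open>x\<close> has size \<open>n - 2\<close>.\<close>
  obtain i where i: "n = N + 2 + 2 * i"
  proof -
    have "even (n - N)" "n - N \<noteq> 0" using assms by auto
    then have "n = N + 2 + 2 * ((n - N - 2) div 2)" using \<open>N < n\<close> by presburger
    then show thesis by (rule that)
  qed
  define P where "P = (\<lambda>t. x (0 + int t)) ` {..<2 * i}"
  have P: "matched P" "card P = 2 * i"
    unfolding P_def using cyclic_arc_matched[OF x(1), of i 0] i by auto
  have "range y \<inter> P = {}" using True by (auto simp: P_def)
  then have "coverable (range y \<union> P)" "card (range y \<union> P) = N + 2 * i"
    using y P by (auto intro!: coverable_Un[OF cyclic_coverable matched_coverable]
      simp: card_Un_disjoint cyclic_finite cyclic_card matched_finite)
  then show ?thesis using i by (intro exI[of _ "range y \<union> P"]) auto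
next
  case False
  \<comment> \<open>Both cycles are shifted so that they start at a common vertex.\<close>
  then obtain z0 b where b: "y b = x z0" by auto
  define x' where "x' i = x (i + z0)" for i
  define y' where "y' i = y (i + b)" for i
  have x': "cyclic x' n" and y': "cyclic y' N" and start: "y' 0 = x' 0"
    using cyclic_shift[OF x(1), of z0] cyclic_shift[OF y(1), of b] b
    by (simp_all add: x'_def[abs_def] y'_def[abs_def])
  show ?thesis
  proof (rule ccontr)
    assume none: "\<not> ?thesis"
    \<comment> \<open>Positions \<open>z\<close> are assigned only at times when \<open>y'\<close>
      lies on \<open>x'\<close>; between two consecutive such times \<open>y'\<close> runs along an
      ear.\<close>
    have "\<exists>z. x' z = y' (int t) \<and> \<bar>z\<bar> \<le> int t \<and> even (z - int t)"
      if "t \<le> N" "y' (int t) \<in> range x'" for t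
      using that
    proof (induction t rule: less_induct)
      case (less t)
      show ?case
      proof (cases "t = 0")
        case True
        then show ?thesis using start by (intro exI[of _ 0]) auto
      next
        case False
        \<comment> \<open>The last earlier visit to \<open>x'\<close>, so that \<open>y'\<close>
          between the times \<open>s\<close> and \<open>t\<close> is an ear of length
          \<open>c\<close>.\<close>
        define s where "s = Max {s. s < t \<and> y' (int s) \<in> range x'}"
        have fin: "finite {s. s < t \<and> y' (int s) \<in> range x'}" by simp
        have ne: "{s. s < t \<and> y' (int s) \<in> range x'} \<noteq> {}" using False start by auto
        have s: "s < t" "y' (int s) \<in> range x'"
          using Max_in[OF fin ne, folded s_def] by blast+
        have smax: "y' (int u) \<notin> range x'" if "s < u" "u < t" for u
        proof
          assume "y' (int u) \<in> range x'"
          then have "u \<in> {s. s < t \<and> y' (int s) \<in> range x'}" using that(2) by blast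
          from Max_ge[OF fin this, folded s_def] that(1) show False by simp
        qed
        obtain z where z: "x' z = y' (int s)" "\<bar>z\<bar> \<le> int s" "even (z - int s)"
          using less.IH[OF s(1)] s less.prems(1) by auto
        obtain w where w: "y' (int t) = x' w" using less.prems(2) by auto
        define c where "c = t - s"
        have c: "c \<ge> 1" "t = s + c" using s(1) by (auto simp: c_def)
        \<comment> \<open>Since \<open>n\<close> is odd, adding \<open>n\<close> flips the parity.
          The displacements from \<open>z\<close> to \<open>w\<close> with the parity of
          \<open>c\<close> thus form one class modulo \<open>2 * n\<close>, and \<open>d\<close> is
          a representative with \<open>\<bar>d\<bar> \<le> n\<close>.\<close>
        obtain d where d: "x' (z + d) = x' w" "even (d - int c)" "\<bar>d\<bar> \<le> int n"
        proof -
          define e where "e = (if even (w - z - int c) then w - z else w - z + int n)"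
          have e: "even (e - int c)" "int n dvd z + e - w"
            using x(2) by (auto simp: e_def)
          define m where "m = e mod (2 * int n)"
          have m: "0 \<le> m" "m < 2 * int n" "2 * int n dvd m - e"
            using x(2) by (auto simp: m_def odd_pos mod_eq_dvd_iff[symmetric])
          define d where "d = (if m \<le> int n then m else m - 2 * int n)"
          have "\<bar>d\<bar> \<le> int n" using m by (auto simp: d_def)
          moreover have de: "2 * int n dvd d - e"
          proof (cases "m \<le> int n")
            case True
            then show ?thesis using m(3) by (simp add: d_def)
          next
            case False
            then have "d - e = m - e - 2 * int n" by (simp add: d_def)
            then show ?thesis using dvd_diff[OF m(3) dvd_refl] by (simp only:)
          qed
          have "even (d - e)" "int n dvd d - e"
            by (rule dvd_mult_left[OF de], rule dvd_mult_right[OF de])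
          then have "even (d - int c)" "int n dvd z + d - w"
            using e dvd_add[of "int n" "d - e" "z + e - w"] by (auto simp: algebra_simps)
          ultimately show thesis
            using that[of d] by (simp add: cyclic_eq_iff[OF x'])
        qed
        \<comment> \<open>Otherwise the ear is shorter than the arc of its parity, and rerouting
          \<open>x\<close> through it gives the excluded cover.\<close>
        have "\<bar>d\<bar> \<le> int c"
        proof (rule ccontr)
          assume "\<not> \<bar>d\<bar> \<le> int c"
          moreover have "inj_on (\<lambda>i. y' (int s + int i)) {0<..<c}"
          proof -
            have "inj_on y' ((\<lambda>i. int s + int i) ` {0<..<c})"
              by (rule cyclic_inj[OF y']) (use c less.prems(1) in auto)
            then show ?thesis by (auto simp: inj_on_def)
          qed
          moreover have "y' (int s + int i) \<notin> range x'" if "0 < i" "i < c" for i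
            using smax[of "s + i"] that c by simp
          moreover have "E (y' (int s + int i)) (y' (int s + int (Suc i)))" for i
            using cyclic_edge[OF y', of "int s + int i"] by (simp add: algebra_simps)
          moreover have "y' (int s + int 0) = x' z" "y' (int s + int c) = x' (z + d)"
            using z d w c by auto
          ultimately show False
            using none d ear_coverable[OF x' c(1), of "\<lambda>i. y' (int s + int i)" z d] by auto
        qed
        moreover have "even ((z + d) - int t)"
          using z(3) d(2) c(2) by auto
        ultimately show ?thesis
          using d w z c by (intro exI[of _ "z + d"]) auto
      qed
    qed
    moreover have "y' (int N) = y' 0"
      by (simp add: cyclic_eq_iff[OF y'])
    ultimately obtain z where z: "x' z = x' 0" "\<bar>z\<bar> \<le> int N" "even (z - int N)"
      using start by (metis order_refl rangeI)
    then have "int n dvd z" by (simp add: cyclic_eq_iff[OF x'])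
    then have "z = 0" using z(2) \<open>N < n\<close> dvd_imp_le_int[of z "int n"] by auto
    then show False using z(3) y(2) by auto
  qed
qed

section \<open>Constraints on the sizes of covers\<close>

text \<open>Descent from \<open>j\<close> in steps of 2. A cover \<open>W\<close> that cannot shrink
  in the evident way is a single odd cycle, and it is longer than the odd cycle contained in
  \<open>Z\<close>, so the comparison of two odd cycles applies.\<close>

lemma coverable_odd_gap:
  assumes "coverable X" "card X = 2 * j + 1" "coverable Z" "card Z = 2 * l + 1" "l \<le> i" "i \<le> j"
  shows "\<exists>Y. coverable Y \<and> card Y = 2 * i + 1"
  using assms(6,5)
proof (induction i rule: inc_induct)
  case base
  then show ?case using assms by blast
next
  case (step i)
  then obtain W where W: "coverable W" "card W = 2 * Suc i + 1" by auto
  show ?case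
  proof (cases "\<exists>Y. coverable Y \<and> card Y + 2 = card W")
    case True
    then show ?thesis using W by auto
  next
    case False
    then obtain x where x: "cyclic x (card W)"
      using coverable_odd_step_or_cycle[OF W(1)] W(2) by auto
    obtain y N where y: "odd N" "cyclic y N" "range y \<subseteq> Z" "coverable (Z - range y)"
      using coverable_odd_cycle[OF assms(3)] assms(4) by (metis even_add even_mult_iff even_numeral odd_one)
    have "N \<le> card Z"
      using cyclic_card_Diff[OF y(2-4)] by simp
    then have "N < card W" using W assms(4) step by simp
    then have "\<exists>Y. coverable Y \<and> card Y + 2 = card W"
      using short_odd_cycle_imp_coverable[OF x _ y(2,1)] W(2) by simp
    then show ?thesis using False by simp
  qed
qed

text \<open>If \<open>X\<close> is matched, an odd cycle of length \<open>N \<le> 2 * l + 1\<close>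
  from \<open>Z\<close> spoils at most \<open>N\<close> of its edges. The cycle and the surviving
  edges form an odd cover of size at least \<open>2 * m - N\<close>. Otherwise \<open>X\<close>
  loses one vertex, and \<open>k = m - 1\<close>.\<close>

lemma coverable_even_bound:
  assumes "coverable X" "card X = 2 * m" "coverable Z" "card Z = 2 * l + 1"
  shows "\<exists>Y k. coverable Y \<and> card Y = 2 * k + 1 \<and> m \<le> l + k + 1"
  using coverable_pred_or_matched[OF assms(1)]
proof (elim disjE exE conjE)
  assume "matched X"
  obtain y N where y: "odd N" "cyclic y N" "range y \<subseteq> Z" "coverable (Z - range y)"
    using coverable_odd_cycle[OF assms(3)] assms(4) by (metis even_add even_mult_iff even_numeral odd_one)
  have N: "N \<le> 2 * l + 1"
    using cyclic_card_Diff[OF y(2-4)] assms(4) by simp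
  obtain T where T: "T \<subseteq> X - range y" "matched T" "card X \<le> card T + 2 * card (X \<inter> range y)"
    using matched_avoid[OF \<open>matched X\<close> cyclic_finite[OF y(2)]] by blast
  have "card (X \<inter> range y) \<le> N"
    using card_mono[of "range y" "X \<inter> range y"] cyclic_finite[OF y(2)] cyclic_card[OF y(2)] by auto
  moreover have "coverable (range y \<union> T)" "card (range y \<union> T) = N + card T"
    using T y by (auto intro!: coverable_Un[OF cyclic_coverable matched_coverable]
      card_Un_disjoint[THEN trans] simp: cyclic_finite cyclic_card matched_finite)
  moreover have "even (card T)" using T(2) by (rule matched_even)
  ultimately show ?thesis
    using T(3) N y(1) assms(2)
    by (intro exI[of _ "range y \<union> T"] exI[of _ "(N + card T) div 2"]) auto
next
  fix Y assume Y: "coverable Y" "card Y + 1 = card X"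
  then have "card Y = 2 * (m - 1) + 1" "m \<le> l + (m - 1) + 1" using assms(2) by auto
  then show ?thesis using Y by blast
qed

text \<open>Both neighbours of \<open>u\<close> along the cycle would be the same vertex, so the
  length divides 2. Being odd it is 1, and \<open>u\<close> would carry a loop.\<close>

lemma odd_cycle_avoids_leaf:
  assumes g: "cyclic g c" "odd c" and u: "\<And>v w. E u v \<Longrightarrow> E u w \<Longrightarrow> v = w" "\<not> E u u"
  shows "u \<notin> range g"
proof
  assume "u \<in> range g"
  then obtain a where a: "u = g a" by auto
  have "E u (g (a + 1))" using cyclic_edge[OF g(1), of a] a by simp
  moreover have "E u (g (a - 1))" using E_sym[OF cyclic_edge[OF g(1), of "a - 1"]] a by simp
  ultimately have "g (a + 1) = g (a - 1)" by (rule u(1))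
  then have "int c dvd 2" by (simp add: cyclic_eq_iff[OF g(1)])
  then have "c dvd 2" by (metis int_dvd_int_iff of_nat_numeral)
  then have "c \<le> 2" by (rule dvd_imp_le) simp
  moreover have "c \<noteq> 2" "c \<ge> 1" using g by (auto dest: cyclic_pos)
  ultimately have "c = 1" by linarith
  then have "g (a + 1) = g a" by (simp add: cyclic_eq_iff[OF g(1)])
  then show False using \<open>E u (g (a + 1))\<close> u(2) a by simp
qed

lemma coverable_subset_support:
  assumes "coverable I" "\<And>a b. E a b \<Longrightarrow> a \<in> V"
  shows "I \<subseteq> V"
  using assms unfolding coverable_def by blast

end

subsection \<open>Cycles with pendant edges\<close>

text \<open>The cycle is \<open>0, \<dots>, N - 1\<close> (a loop if \<open>N = 1\<close>), the vertex \<open>N + a\<close> hangs on \<open>a < s\<close>, and \<open>e\<close>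
  disjoint edges follow.\<close>

definition sun_edge :: "nat \<Rightarrow> nat \<Rightarrow> nat \<Rightarrow> nat \<Rightarrow> nat \<Rightarrow> bool" where
  "sun_edge N s e a b \<longleftrightarrow> a < N \<and> b = Suc a mod N \<or> a < s \<and> b = N + a
     \<or> (\<exists>i<e. a = N + s + 2 * i \<and> b = a + 1)"

definition sun :: "nat \<Rightarrow> nat \<Rightarrow> nat \<Rightarrow> nat \<Rightarrow> nat \<Rightarrow> bool" where
  "sun N s e a b \<longleftrightarrow> sun_edge N s e a b \<or> sun_edge N s e b a"

lemma looped_graph_sun: "looped_graph (sun N s e)"
  by standard (auto simp: sun_def)

lemma sun_bound: "s \<le> N \<Longrightarrow> sun N s e a b \<Longrightarrow> a < N + s + 2 * e"
  unfolding sun_def sun_edge_def by (auto intro: less_le_trans[OF mod_less_divisor])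

lemma sun_leaf:
  assumes "s \<le> N" "N \<le> u" "sun N s e u v" "sun N s e u w"
  shows "v = w"
proof -
  \<comment> \<open>The only possible neighbour: the cycle vertex on which \<open>u\<close> hangs,
    or the other end of its isolated edge.\<close>
  have "x = (if u < N + s then u - N else if even (u - (N + s)) then u + 1 else u - 1)"
    if "sun N s e u x" for x
    using that unfolding sun_def
  proof
    assume "sun_edge N s e u x"
    then have "\<exists>i<e. u = N + s + 2 * i \<and> x = u + 1"
      using assms(1,2) unfolding sun_edge_def by (elim disjE) auto
    then show ?thesis by auto
  next
    assume "sun_edge N s e x u"
    then show ?thesis
      unfolding sun_edge_def
    proof (elim disjE)
      assume "x < N \<and> u = Suc x mod N"
      then have "u < N" by simp
      then show ?thesis using assms(2) by simp
    qed auto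
  qed
  from this[OF assms(3)] this[OF assms(4)] show ?thesis by simp
qed

lemma sun_loop: "s \<le> N \<Longrightarrow> sun N s e u u \<Longrightarrow> N = 1 \<and> u = 0"
proof -
  assume "s \<le> N" "sun N s e u u"
  then have u: "u < N" "u = Suc u mod N" by (auto simp: sun_def sun_edge_def)
  then have "\<not> Suc u < N" by auto
  then have "Suc u = N" using u(1) by simp
  then show ?thesis using u by auto
qed

text \<open>Working modulo \<open>N\<close> absorbs the edge between \<open>N - 1\<close> and
  \<open>0\<close>, and the loop if \<open>N = 1\<close>.\<close>

lemma sun_cycle_step:
  assumes "s \<le> N" "sun N s e a b" "a < N" "b < N"
  shows "\<exists>d\<in>{1, -1}. int N dvd int b - int a - d"
proof -
  have "int N dvd int (Suc c mod N) - int c - 1" for c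
  proof -
    have "int N dvd int (Suc c) mod int N - int (Suc c)"
      by (simp add: mod_eq_dvd_iff[symmetric])
    then show ?thesis by (simp add: zmod_int algebra_simps)
  qed
  moreover have "b = Suc a mod N \<or> a = Suc b mod N"
    using assms by (auto simp: sun_def sun_edge_def)
  moreover have "int b - int a - (-1) = - (int a - int b - 1)" by simp
  ultimately show ?thesis by (metis dvd_minus_iff insertI1 insertI2)
qed

text \<open>The steps \<open>\<plusminus>1\<close> of an odd closed walk on a cycle of length \<open>N\<close> add up to an odd multiple of \<open>N\<close>.\<close>

lemma odd_cycle_in_sun:
  assumes "s \<le> N" "looped_graph.cyclic (sun N s e) g c" "odd c"
  shows "range g = {..<N}"
proof -
  interpret looped_graph "sun N s e" by (rule looped_graph_sun)
  have sub: "range g \<subseteq> {..<N}"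
  proof
    fix u assume "u \<in> range g"
    show "u \<in> {..<N}"
    proof (rule ccontr)
      assume "u \<notin> {..<N}"
      then have "N \<le> u" by simp
      then have "u \<notin> range g"
        using assms(1) sun_leaf[OF assms(1)] sun_loop[OF assms(1), of e u]
        by (intro odd_cycle_avoids_leaf[OF assms(2,3)]) auto
      then show False using \<open>u \<in> range g\<close> by simp
    qed
  qed
  have "\<exists>d\<in>{1, -1}. int N dvd int (g (a + 1)) - int (g a) - d" for a
    using sub by (intro sun_cycle_step[OF assms(1) cyclic_edge[OF assms(2)]]) auto
  then obtain d where d: "\<And>a. d a \<in> {1, -1}"
    "\<And>a. int N dvd int (g (a + 1)) - int (g a) - d a" by metis
  \<comment> \<open>The partial sums track the position modulo \<open>N\<close>, have the parity of
    \<open>t\<close> and do not exceed \<open>t\<close> in absolute value.\<close>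
  have "int N dvd int (g (int t)) - int (g 0) - (\<Sum>i<t. d (int i)) \<and> even ((\<Sum>i<t. d (int i)) - int t)
    \<and> \<bar>\<Sum>i<t. d (int i)\<bar> \<le> int t" for t
  proof (induction t)
    case (Suc t)
    have "int N dvd (int (g (int t)) - int (g 0) - (\<Sum>i<t. d (int i)))
      + (int (g (int t + 1)) - int (g (int t)) - d (int t))"
      using Suc d(2) by (intro dvd_add) auto
    then show ?case using Suc d(1)[of "int t"] by (auto simp: algebra_simps)
  qed simp
  \<comment> \<open>After a full turn the sum is odd, hence a nonzero multiple of \<open>N\<close>.
    So \<open>N \<le> c\<close>, while \<open>g\<close> visits only vertices below
    \<open>N\<close>.\<close>
  from this[of c] have "int N dvd (\<Sum>i<c. d (int i))" "odd (\<Sum>i<c. d (int i))"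
    "\<bar>\<Sum>i<c. d (int i)\<bar> \<le> int c"
    using assms(3) cyclic_eq_iff[OF assms(2), of "int c" 0] by auto
  then have "N \<le> c"
    using dvd_imp_le_int[of "\<Sum>i<c. d (int i)" "int N"] by fastforce
  then show ?thesis
    using sub cyclic_card[OF assms(2)] by (intro card_subset_eq) (auto dest: card_mono[rotated])
qed

text \<open>The odd cycle of the cover uses up \<open>0, ..., N - 1\<close>. Pendant vertices then
  have no neighbour left, so the rest of the cover lies on the isolated edges.\<close>

lemma sun_odd_coverable:
  assumes "s \<le> N" "looped_graph.coverable (sun N s e) I" "odd (card I)"
  shows "N \<ge> 1" "N \<le> card I" "card I \<le> N + 2 * e"
proof -
  interpret looped_graph "sun N s e" by (rule looped_graph_sun)
  obtain g c where g: "odd c" "cyclic g c" "range g \<subseteq> I" "coverable (I - range g)"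
    using coverable_odd_cycle[OF assms(2,3)] by metis
  have r: "range g = {..<N}" by (rule odd_cycle_in_sun[OF assms(1) g(2,1)])
  then have c: "c = N" using cyclic_card[OF g(2)] by simp
  have card: "card I = card (I - range g) + N" using cyclic_card_Diff[OF g(2-4)] c by simp
  have "I - range g \<subseteq> {N + s..<N + s + 2 * e}"
  proof
    fix v assume v: "v \<in> I - range g"
    obtain p where p: "bij_betw p (I - range g) (I - range g)" "\<And>i. i \<in> I - range g \<Longrightarrow> sun N s e i (p i)"
      using g(4) unfolding coverable_def by blast
    have "p v \<in> I - range g" using v bij_betwE[OF p(1)] by blast
    then have "N \<le> v" "N \<le> p v" "sun N s e v (p v)"
      using v p(2) r by (auto simp: not_less)
    moreover from this have "N + s \<le> v"
      using assms(1) by (auto simp: sun_def sun_edge_def not_le[symmetric])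
    ultimately show "v \<in> {N + s..<N + s + 2 * e}" using sun_bound[OF assms(1)] by auto
  qed
  from card_mono[OF _ this] card show "N \<le> card I" "card I \<le> N + 2 * e" by auto
  show "N \<ge> 1" using c g(1) by (cases N) auto
qed

lemma sun_coverable_card:
  assumes "s \<le> N" "looped_graph.coverable (sun N s e) I"
  shows "card I \<le> N + s + 2 * e"
proof -
  interpret looped_graph "sun N s e" by (rule looped_graph_sun)
  have "I \<subseteq> {..<N + s + 2 * e}"
    by (rule coverable_subset_support[OF assms(2)]) (use sun_bound[OF assms(1)] in auto)
  from card_mono[OF _ this] show ?thesis by simp
qed

lemma sun_matched_edges:
  assumes "i \<le> e"
  shows "looped_graph.matched (sun N s e) {N + s..<N + s + 2 * i}"
proof -
  interpret looped_graph "sun N s e" by (rule looped_graph_sun)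
  have "matched ((\<lambda>t. N + s + t) ` {..<2 * i})"
    using assms by (intro matched_path) (auto simp: sun_def sun_edge_def)
  then show ?thesis by (simp add: lessThan_atLeast0 add.commute)
qed

lemma sun_coverable_odd:
  assumes "N \<ge> 1" "i \<le> e"
  shows "\<exists>I. looped_graph.coverable (sun N s e) I \<and> card I = N + 2 * i"
proof -
  interpret looped_graph "sun N s e" by (rule looped_graph_sun)
  \<comment> \<open>Reduction modulo \<open>N\<close> closes the path, since its value at
    \<open>N\<close> is 0.\<close>
  have "\<exists>g. cyclic g N \<and> range g = (\<lambda>a. a mod N) ` {..<N}"
    using assms(1) by (intro cyclic_of_path) (auto simp: inj_on_def sun_def sun_edge_def)
  moreover have "(\<lambda>a. a mod N) ` {..<N} = {..<N}" by (auto simp: image_iff)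
  ultimately have "coverable {..<N}" using cyclic_coverable by metis
  then have "coverable ({..<N} \<union> {N + s..<N + s + 2 * i})"
    using matched_coverable[OF sun_matched_edges[OF assms(2)]] by (rule coverable_Un) auto
  moreover have "card ({..<N} \<union> {N + s..<N + s + 2 * i}) = N + 2 * i"
    by (subst card_Un_disjoint) auto
  ultimately show ?thesis by blast
qed

text \<open>The \<open>s\<close> pendant edges, \<open>q\<close> edges on the arc
  \<open>s, ..., s + 2 * q - 1\<close> of the cycle and the \<open>e\<close> isolated edges form a
  matching, from which \<open>i\<close> edges are kept.\<close>

lemma sun_coverable_even:
  assumes "s + 2 * q \<le> N" "i \<le> s + q + e"
  shows "\<exists>I. looped_graph.coverable (sun N s e) I \<and> card I = 2 * i"
proof -
  interpret looped_graph "sun N s e" by (rule looped_graph_sun)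
  \<comment> \<open>Lists the pendant edges: position \<open>2 * a\<close> is the cycle vertex
    \<open>a\<close>, and position \<open>2 * a + 1\<close> is \<open>N + a\<close>, which hangs on
    it.\<close>
  define h where "h t = (if even t then t div 2 else N + t div 2)" for t
  have inj: "inj_on h {..<2 * s}"
    using assms(1) by (intro inj_onI) (auto simp: h_def split: if_splits elim!: evenE oddE)
  have rays: "matched (h ` {..<2 * s})"
    using inj by (intro matched_path) (auto simp: h_def sun_def sun_edge_def)
  have sub: "h ` {..<2 * s} \<subseteq> {..<s} \<union> {N..<N + s}" by (auto simp: h_def)
  have "matched ((\<lambda>t. s + t) ` {..<2 * q})"
    using assms(1) by (intro matched_path) (auto simp: sun_def sun_edge_def)
  then have arc: "matched {s..<s + 2 * q}" by (simp add: lessThan_atLeast0 add.commute)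
  define M where "M = h ` {..<2 * s} \<union> {s..<s + 2 * q} \<union> {N + s..<N + s + 2 * e}"
  have "matched M"
    unfolding M_def using assms(1) sub
    by (intro matched_Un rays arc sun_matched_edges order_refl) fastforce+
  moreover have "card M = 2 * (s + q + e)"
  proof -
    have "card (h ` {..<2 * s} \<union> {s..<s + 2 * q}) = 2 * s + 2 * q"
      using assms(1) sub inj by (subst card_Un_disjoint) (fastforce simp: card_image)+
    then show ?thesis
      unfolding M_def using assms(1) sub by (subst card_Un_disjoint) fastforce+
  qed
  ultimately obtain T where "matched T" "card T = 2 * i"
    using matched_subset[of M i] assms(2) by auto
  then show ?thesis using matched_coverable by blast
qed

subsection \<open>Permanents of principal submatrices\<close>

text \<open>A submatrix is indexed by \<open>0..<card I\<close> while its vertices are the elements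
  of \<open>I\<close>; conjugation by the enumeration passes between the two.\<close>

lemma (in looped_graph) coverable_transport:
  assumes "finite K" "bij_betw f K I"
  shows "coverable I \<longleftrightarrow> (\<exists>p. p permutes K \<and> (\<forall>i\<in>K. E (f i) (f (p i))))"
proof
  assume "coverable I"
  then obtain q where q: "bij_betw q I I" "\<And>i. i \<in> I \<Longrightarrow> E i (q i)"
    unfolding coverable_def by blast
  define g where "g = inv_into K f"
  have g: "bij_betw g I K" "\<And>v. v \<in> I \<Longrightarrow> f (g v) = v"
    using assms(2) bij_betw_inv_into[OF assms(2)] by (auto simp: g_def bij_betw_def f_inv_into_f)
  define p where "p i = (if i \<in> K then g (q (f i)) else i)" for i
  have "bij_betw (g \<circ> (q \<circ> f)) K K"
    using assms(2) q(1) g(1) by (blast intro: bij_betw_trans)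
  then have "bij_betw p K K" by (simp add: p_def cong: bij_betw_cong)
  then have "p permutes K" by (rule bij_imp_permutes) (simp add: p_def)
  moreover have "E (f i) (f (p i))" if "i \<in> K" for i
    using that q g assms(2) by (simp add: p_def bij_betwE)
  ultimately show "\<exists>p. p permutes K \<and> (\<forall>i\<in>K. E (f i) (f (p i)))" by blast
next
  assume "\<exists>p. p permutes K \<and> (\<forall>i\<in>K. E (f i) (f (p i)))"
  then obtain p where p: "p permutes K" "\<And>i. i \<in> K \<Longrightarrow> E (f i) (f (p i))" by blast
  define g where "g = inv_into K f"
  have g: "bij_betw g I K" "\<And>i. i \<in> K \<Longrightarrow> g (f i) = i"
    using assms(2) bij_betw_inv_into[OF assms(2)] by (auto simp: g_def bij_betw_def)
  have "bij_betw (f \<circ> (p \<circ> g)) I I"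
    using assms(2) permutes_imp_bij[OF p(1)] g(1) by (blast intro: bij_betw_trans)
  moreover have "E v ((f \<circ> (p \<circ> g)) v)" if v: "v \<in> I" for v
  proof -
    obtain i where "i \<in> K" "v = f i" using v assms(2) by (auto simp: bij_betw_def)
    then show ?thesis using p(2) g(2) by simp
  qed
  moreover have "finite I" using assms by (simp add: bij_betw_finite)
  ultimately show "coverable I" unfolding coverable_def by blast
qed

text \<open>\<open>pick\<close> enumerates increasingly, so an element sits at the position given by
  the number of smaller elements.\<close>

lemma bij_betw_pick:
  assumes "finite I"
  shows "bij_betw (pick I) {0..<card I} I"
proof -
  have "inj_on (pick I) {0..<card I}"
    by (rule linorder_inj_onI) (auto dest: pick_mono_le)
  moreover have "pick I ` {0..<card I} = I"
  proof
    show "pick I ` {0..<card I} \<subseteq> I" by (auto intro: pick_in_set_le)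
    show "I \<subseteq> pick I ` {0..<card I}"
    proof
      fix i assume i: "i \<in> I"
      then have "card {a \<in> I. a < i} < card I"
        using assms by (intro psubset_card_mono) auto
      then show "i \<in> pick I ` {0..<card I}"
        by (intro image_eqI[where x = "card {a \<in> I. a < i}"]) (use pick_card_in_set[OF i] in auto)
    qed
  qed
  ultimately show ?thesis by (simp add: bij_betw_def)
qed

text \<open>The bounds keep unspecified entries outside the matrix from becoming edges.\<close>

definition entry_graph :: "'a::zero mat \<Rightarrow> nat \<Rightarrow> nat \<Rightarrow> bool" where
  "entry_graph A i j \<longleftrightarrow> i < dim_row A \<and> j < dim_row A \<and> A $$ (i, j) \<noteq> 0"

text \<open>Nonnegative summands cannot cancel, so one nonzero product suffices.\<close>

lemma permanent_nonneg_nonzero_iff: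
  fixes B :: "'a::linordered_semidom mat"
  assumes "\<And>i j. i < dim_row B \<Longrightarrow> j < dim_row B \<Longrightarrow> 0 \<le> B $$ (i, j)"
  shows "permanent B \<noteq> 0 \<longleftrightarrow>
    (\<exists>p. p permutes {0..<dim_row B} \<and> (\<forall>i\<in>{0..<dim_row B}. B $$ (i, p i) \<noteq> 0))"
proof -
  have fin: "finite {p. p permutes {0..<dim_row B}}" by (rule finite_permutations) simp
  have "0 \<le> (\<Prod>i = 0..<dim_row B. B $$ (i, p i))" if "p permutes {0..<dim_row B}" for p
    using assms permutes_in_image[OF that] by (intro prod_nonneg) auto
  then have "permanent B = 0 \<longleftrightarrow>
    (\<forall>p\<in>{p. p permutes {0..<dim_row B}}. (\<Prod>i = 0..<dim_row B. B $$ (i, p i)) = 0)"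
    unfolding permanent_def by (intro sum_nonneg_eq_0_iff fin) auto
  then show ?thesis by auto
qed

lemma permanent_submatrix_nonzero_iff:
  fixes A :: "real mat"
  assumes A: "A \<in> carrier_mat n n" "\<And>i j. i < n \<Longrightarrow> j < n \<Longrightarrow> 0 \<le> A $$ (i, j)"
    and G: "looped_graph (entry_graph A)" and I: "I \<subseteq> {0..<n}"
  shows "permanent (submatrix A I I) \<noteq> 0 \<longleftrightarrow> looped_graph.coverable (entry_graph A) I"
proof -
  interpret looped_graph "entry_graph A" by (rule G)
  define B where "B = submatrix A I I"
  have fin: "finite I" using I finite_subset by blast
  have eq: "{i. i < n \<and> i \<in> I} = I" using I by auto
  have dim: "dim_row B = card I" using A(1) eq by (simp add: B_def dim_submatrix)
  have entry: "B $$ (i, j) = A $$ (pick I i, pick I j)" if "i < card I" "j < card I" for i j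
    using that A(1) eq by (simp add: B_def submatrix_index)
  have lt: "pick I i < n" if "i < card I" for i
    using pick_in_set_le[OF that] I by auto
  have "permanent B \<noteq> 0 \<longleftrightarrow>
    (\<exists>p. p permutes {0..<card I} \<and> (\<forall>i\<in>{0..<card I}. B $$ (i, p i) \<noteq> 0))"
    unfolding dim[symmetric] by (rule permanent_nonneg_nonzero_iff) (auto simp: dim entry lt A)
  also have "\<dots> \<longleftrightarrow> (\<exists>p. p permutes {0..<card I} \<and> (\<forall>i\<in>{0..<card I}. entry_graph A (pick I i) (pick I (p i))))"
  proof (intro ex_cong1 conj_cong ball_cong refl)
    fix p i assume "p permutes {0..<card I}" "i \<in> {0..<card I}"
    moreover from this have "p i \<in> {0..<card I}" by (simp only: permutes_in_image)
    ultimately show "B $$ (i, p i) \<noteq> 0 \<longleftrightarrow> entry_graph A (pick I i) (pick I (p i))"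
      using A(1) lt by (simp add: entry entry_graph_def)
  qed
  also have "\<dots> \<longleftrightarrow> coverable I"
    by (rule coverable_transport[symmetric]) (auto intro: bij_betw_pick fin)
  finally show ?thesis unfolding B_def .
qed

section \<open>Passage between matrices and graphs\<close>

text \<open>A zero on the diagonal is a vertex without a loop. Covers lie in \<open>{0..<n}\<close>
  automatically because edges do.\<close>

definition realizes :: "(nat \<Rightarrow> nat \<Rightarrow> bool) \<Rightarrow> nat \<Rightarrow> nat list \<Rightarrow> bool" where
  "realizes E n r \<longleftrightarrow> looped_graph E \<and> (\<forall>i j. E i j \<longrightarrow> i < n \<and> j < n)
    \<and> (r ! 0 = 1 \<longleftrightarrow> (\<exists>i<n. \<not> E i i))
    \<and> (\<forall>k. 1 \<le> k \<and> k \<le> n \<longrightarrow> (r ! k = 1 \<longleftrightarrow> (\<exists>I. looped_graph.coverable E I \<and> card I = k)))"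

text \<open>Only the zero pattern matters: a matrix yields its \<open>entry_graph\<close>, and a
  graph yields its 0/1 adjacency matrix.\<close>

lemma ppr_sequence_realizable_iff:
  assumes "length r = n + 1" "set r \<subseteq> {0, 1}"
  shows "(\<exists>A :: real mat. A \<in> carrier_mat n n \<and> transpose_mat A = A \<and>
            (\<forall>i<n. \<forall>j<n. 0 \<le> A $$ (i, j)) \<and> ppr_sequence A = r)
    \<longleftrightarrow> (\<exists>E. realizes E n r)"
    (is "?M \<longleftrightarrow> _")
proof -
  have seq: "ppr_sequence A = r \<longleftrightarrow> realizes (entry_graph A) n r"
    if A: "A \<in> carrier_mat n n" and G: "looped_graph (entry_graph A)"
      and nn: "\<forall>i<n. \<forall>j<n. 0 \<le> A $$ (i, j)" for A :: "real mat"
  proof -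
    interpret looped_graph "entry_graph A" by (rule G)
    have sub: "I \<subseteq> {0..<n}" if "coverable I" for I
      using that A unfolding coverable_def entry_graph_def by auto
    have bin: "r ! k = 0 \<or> r ! k = 1" if "k \<le> n" for k
    proof -
      have "r ! k \<in> set r" using assms(1) that by (intro nth_mem) simp
      then show ?thesis using assms(2) by blast
    qed
    have pos: "ppr A k = (if \<exists>I. coverable I \<and> card I = k then 1 else 0)" if "1 \<le> k" for k
    proof -
      have "I \<subseteq> {0..<n} \<and> card I = k \<and> permanent (submatrix A I I) \<noteq> 0 \<longleftrightarrow> coverable I \<and> card I = k" for I
        using permanent_submatrix_nonzero_iff[OF A _ G, of I] nn sub[of I] by blast
      then show ?thesis using that A by (simp add: ppr_def)
    qed
    have zero: "ppr A 0 = (if \<exists>i<n. \<not> entry_graph A i i then 1 else 0)"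
      using A by (auto simp: ppr_def entry_graph_def)
    have "ppr_sequence A = r \<longleftrightarrow> (\<forall>k\<le>n. ppr A k = r ! k)"
      using A assms(1) by (auto simp: ppr_sequence_def list_eq_iff_nth_eq less_Suc_eq_le simp del: upt_Suc)
    also have "\<dots> \<longleftrightarrow> ppr A 0 = r ! 0 \<and> (\<forall>k. 1 \<le> k \<and> k \<le> n \<longrightarrow> ppr A k = r ! k)"
      by (metis One_nat_def Suc_leI le0 not_gr_zero)
    also have "ppr A 0 = r ! 0 \<longleftrightarrow> (r ! 0 = 1 \<longleftrightarrow> (\<exists>i<n. \<not> entry_graph A i i))"
      using bin[of 0] zero by auto
    also have "(\<forall>k. 1 \<le> k \<and> k \<le> n \<longrightarrow> ppr A k = r ! k) \<longleftrightarrow>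
      (\<forall>k. 1 \<le> k \<and> k \<le> n \<longrightarrow> (r ! k = 1 \<longleftrightarrow> (\<exists>I. coverable I \<and> card I = k)))"
      using bin pos by (intro all_cong) (auto split: if_splits)
    finally show ?thesis using A G by (auto simp: realizes_def entry_graph_def)
  qed
  show ?thesis
  proof
    assume ?M
    then obtain A :: "real mat" where A: "A \<in> carrier_mat n n" "transpose_mat A = A"
      "\<forall>i<n. \<forall>j<n. 0 \<le> A $$ (i, j)" "ppr_sequence A = r" by blast
    have "looped_graph (entry_graph A)"
    proof
      fix a b assume ab: "entry_graph A a b"
      then have "A $$ (b, a) = transpose_mat A $$ (a, b)"
        using A(1) by (auto simp: entry_graph_def)
      then show "entry_graph A b a"
        using ab A(2) by (auto simp: entry_graph_def)
    qed
    then show "\<exists>E. realizes E n r"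
      using seq[OF A(1) _ A(3)] A(4) by auto
  next
    assume "\<exists>E. realizes E n r"
    then obtain E where E: "realizes E n r" by (elim exE)
    then have G: "looped_graph E" and supp: "\<And>i j. E i j \<Longrightarrow> i < n \<and> j < n"
      by (simp_all add: realizes_def)
    define A :: "real mat" where "A = mat n n (\<lambda>(i, j). if E i j then 1 else 0)"
    have A: "A \<in> carrier_mat n n" "\<forall>i<n. \<forall>j<n. 0 \<le> A $$ (i, j)"
      by (auto simp: A_def)
    have EA: "entry_graph A = E"
      using supp by (intro ext) (auto simp: A_def entry_graph_def split: if_splits)
    have "transpose_mat A = A"
      using G by (intro eq_matI) (auto simp: A_def looped_graph_def)
    moreover have "ppr_sequence A = r"
      using seq[OF A(1) _ A(2)] E G by (simp add: EA)
    ultimately show ?M using A by (intro exI[of _ A] conjI)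
  qed
qed

section \<open>The characterization\<close>

lemma (in looped_graph) coverable_loops: "finite I \<Longrightarrow> (\<And>i. i \<in> I \<Longrightarrow> E i i) \<Longrightarrow> coverable I"
  unfolding coverable_def by (intro conjI exI[of _ id]) auto

theorem theorem4p6:
  fixes n :: nat and r :: "nat list"
  assumes n: "2 \<le> n"
    and length_r: "length r = n + 1"
    and binary_r: "set r \<subseteq> {0, 1}"
  shows "(\<exists>A :: real mat. A \<in> carrier_mat n n \<and> transpose_mat A = A \<and>
            (\<forall>i<n. \<forall>j<n. 0 \<le> A $$ (i, j)) \<and> ppr_sequence A = r)
     \<longleftrightarrow>
       (r ! 0 = 0 \<and> (\<forall>i. 1 \<le> i \<and> i \<le> n \<longrightarrow> r ! i = 1))
     \<or> (\<exists>l k m :: nat.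
            l \<le> k \<and> k \<le> m \<and> m \<le> l + k + 1 \<and> 2 * k + 1 \<le> n \<and> 2 * m \<le> n
          \<and> (\<forall>j<l. r ! (2 * j + 1) = 0)
          \<and> (\<forall>j. l \<le> j \<and> j \<le> k \<longrightarrow> r ! (2 * j + 1) = 1)
          \<and> (\<forall>j. k < j \<and> 2 * j + 1 \<le> n \<longrightarrow> r ! (2 * j + 1) = 0)
          \<and> (\<forall>j\<le>m. r ! (2 * j) = 1)
          \<and> (\<forall>j. m < j \<and> 2 * j \<le> n \<longrightarrow> r ! (2 * j) = 0))
     \<or> (\<exists>m :: nat.
            m \<le> n div 2
          \<and> r ! 0 = 1
          \<and> (\<forall>i\<le>n. odd i \<longrightarrow> r ! i = 0)
          \<and> (\<forall>i\<le>2 * m. even i \<longrightarrow> r ! i = 1)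
          \<and> (\<forall>i. even i \<and> 2 * m < i \<and> i \<le> n \<longrightarrow> r ! i = 0))"
    (is "_ \<longleftrightarrow> ?full \<or> (\<exists>l k m. ?mixed l k m) \<or> (\<exists>m. ?bipartite m)")
proof -
  have bin: "r ! i = 0 \<or> r ! i = 1" if "i \<le> n" for i
  proof -
    have "r ! i \<in> set r" using length_r that by (intro nth_mem) simp
    then show ?thesis using binary_r by blast
  qed
  have forward: "?full \<or> (\<exists>l k m. ?mixed l k m) \<or> (\<exists>m. ?bipartite m)"
    if "realizes E n r" for E
  proof -
    have G: "looped_graph E" and supp: "\<And>i j. E i j \<Longrightarrow> i < n \<and> j < n"
      and zero: "r ! 0 = 1 \<longleftrightarrow> (\<exists>i<n. \<not> E i i)"
      and pos: "\<And>k. 1 \<le> k \<Longrightarrow> k \<le> n \<Longrightarrow> r ! k = 1 \<longleftrightarrow> (\<exists>I. looped_graph.coverable E I \<and> card I = k)"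
      using that by (auto simp: realizes_def)
    interpret looped_graph E by (rule G)
    define C where "C k \<longleftrightarrow> (\<exists>I. coverable I \<and> card I = k)" for k
    have pos: "r ! k = 1 \<longleftrightarrow> C k" if "1 \<le> k" "k \<le> n" for k
      using pos that by (simp add: C_def)
    have pos0: "r ! k = 0 \<longleftrightarrow> \<not> C k" if "1 \<le> k" "k \<le> n" for k
      using pos[OF that] bin[OF that(2)] by auto
    have Cn: "k \<le> n" if "C k" for k
    proof -
      obtain I where I: "coverable I" "card I = k" using \<open>C k\<close> by (auto simp: C_def)
      have "I \<subseteq> {..<n}" by (rule coverable_subset_support[OF I(1)]) (use supp in auto)
      from card_mono[OF _ this] show ?thesis using I(2) by simp
    qed
    have C0: "C (2 * 0)" using coverable_empty unfolding C_def by force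
    \<comment> \<open>Half the largest even cover size. It exists because the empty set is a cover
      and no cover has more than \<open>n\<close> vertices.\<close>
    define m where "m = (GREATEST m. C (2 * m))"
    have m: "C (2 * m)"
      unfolding m_def by (rule GreatestI_nat[where P = "\<lambda>m. C (2 * m)" and b = n and k = 0]) (use C0 in \<open>auto dest: Cn\<close>)
    have m_max: "j \<le> m" if "C (2 * j)" for j
      unfolding m_def by (rule Greatest_le_nat[where P = "\<lambda>m. C (2 * m)" and b = n, OF that]) (auto dest: Cn)
    have even: "C (2 * j)" if "j \<le> m" for j
      using m coverable_even_down[OF _ _ that] unfolding C_def by blast
    show ?thesis
    proof (cases "r ! 0 = 0")
      case True
      \<comment> \<open>Without a zero on the diagonal every vertex carries a loop, and loops alone
        cover any set.\<close>
      then have loops: "E i i" if "i < n" for i using zero that by simp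
      have "r ! i = 1" if "1 \<le> i" "i \<le> n" for i
      proof -
        have "coverable {..<i}" using loops that by (intro coverable_loops) auto
        then have "C i" unfolding C_def by (intro exI[of _ "{..<i}"]) simp
        then show ?thesis using pos that by blast
      qed
      then show ?thesis using True by blast
    next
      case False
      then have r0: "r ! 0 = 1" using bin[of 0] by simp
      have r_even: "r ! (2 * j) = 1" if "j \<le> m" for j
      proof (cases "j = 0")
        case False
        then show ?thesis using pos[of "2 * j"] even[OF that] Cn[of "2 * j"] by simp
      qed (use r0 in simp)
      have r_even0: "r ! (2 * j) = 0" if "m < j" "2 * j \<le> n" for j
        using pos0[of "2 * j"] m_max[of j] that by auto
      show ?thesis
      proof (cases "\<exists>j. C (2 * j + 1)")
        case True
        define l where "l = (LEAST j. C (2 * j + 1))"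
        define k where "k = (GREATEST j. C (2 * j + 1))"
        obtain j0 where j0: "C (2 * j0 + 1)" using True by blast
        have l: "C (2 * l + 1)" unfolding l_def by (rule LeastI[where P = "\<lambda>j. C (2 * j + 1)", OF j0])
        have l_min: "l \<le> j" if "C (2 * j + 1)" for j
          unfolding l_def by (rule Least_le[where P = "\<lambda>j. C (2 * j + 1)", OF that])
        have k: "C (2 * k + 1)"
          unfolding k_def by (rule GreatestI_nat[where P = "\<lambda>j. C (2 * j + 1)" and b = n, OF j0]) (auto dest: Cn)
        have k_max: "j \<le> k" if "C (2 * j + 1)" for j
          unfolding k_def by (rule Greatest_le_nat[where P = "\<lambda>j. C (2 * j + 1)" and b = n, OF that]) (auto dest: Cn)
        obtain X Y Z where X: "coverable X" "card X = 2 * m" and Y: "coverable Y" "card Y = 2 * k + 1"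
          and Z: "coverable Z" "card Z = 2 * l + 1"
          using m k l unfolding C_def by blast
        have "k \<le> m"
        proof -
          obtain W where "coverable W" "card W + 1 = card Y"
            using coverable_odd_pred[OF Y(1)] Y(2) by auto
          then have "C (2 * k)" using Y(2) unfolding C_def by auto
          then show ?thesis by (rule m_max)
        qed
        moreover have "m \<le> l + k + 1"
        proof -
          obtain W k' where "coverable W" "card W = 2 * k' + 1" "m \<le> l + k' + 1"
            using coverable_even_bound[OF X Z] by blast
          then show ?thesis using k_max[of k'] unfolding C_def by force
        qed
        moreover have odd: "C (2 * j + 1)" if "l \<le> j" "j \<le> k" for j
          using coverable_odd_gap[OF Y Z that] unfolding C_def .
        moreover have kn: "2 * k + 1 \<le> n" and "2 * m \<le> n" using Cn[OF k] Cn[OF m] by auto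
        moreover have "r ! (2 * j + 1) = 0" if "j < l" for j
          using pos0[of "2 * j + 1"] l_min[of j] l_min[OF k] kn that by auto
        moreover have "r ! (2 * j + 1) = 1" if "l \<le> j" "j \<le> k" for j
          using pos[of "2 * j + 1"] odd[OF that] kn that by auto
        moreover have "r ! (2 * j + 1) = 0" if "k < j" "2 * j + 1 \<le> n" for j
          using pos0[of "2 * j + 1"] k_max[of j] that by auto
        ultimately have "?mixed l k m"
          using l_min[OF k] r_even r_even0 by simp
        then show ?thesis by (intro disjI2 disjI1 exI)
      next
        case False
        then have odd: "\<not> C i" if "odd i" for i using that by (auto elim: oddE)
        have "?bipartite m"
        proof (intro conjI allI impI)
          show "m \<le> n div 2" using Cn[OF m] by simp
          show "r ! 0 = 1" by (rule r0)
          show "r ! i = 0" if "i \<le> n" "odd i" for i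
            using odd[OF that(2)] pos0[of i] that by (simp add: Suc_leI odd_pos)
          show "r ! i = 1" if "i \<le> 2 * m" "even i" for i
            using that r_even by (auto elim!: evenE)
          show "r ! i = 0" if "even i \<and> 2 * m < i \<and> i \<le> n" for i
            using that r_even0 by (auto elim!: evenE)
        qed
        then show ?thesis by (intro disjI2 exI)
      qed
    qed
  qed
  have backward: "\<exists>E. realizes E n r"
    if "?full \<or> (\<exists>l k m. ?mixed l k m) \<or> (\<exists>m. ?bipartite m)"
    using that
  proof (elim disjE exE)
    assume full: ?full
    define E where "E i j \<longleftrightarrow> i = j \<and> i < n" for i j :: nat
    interpret looped_graph E by standard (auto simp: E_def)
    have "\<exists>I. coverable I \<and> card I = k" if "k \<le> n" for k
      using that by (intro exI[of _ "{..<k}"] conjI coverable_loops) (auto simp: E_def)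
    then have "realizes E n r"
      using full looped_graph_axioms by (auto simp: realizes_def E_def)
    then show ?thesis by (intro exI[of _ "E"])
  next
    fix l k m assume mixed: "?mixed l k m"
    \<comment> \<open>The odd covers are to have sizes from \<open>N = 2 * l + 1\<close> to
      \<open>N + 2 * e = 2 * k + 1\<close>. The matching has \<open>s + (N - s) div 2 + e\<close>
      edges, which is \<open>m\<close> for this \<open>s\<close>, both for \<open>m = k\<close> and
      for \<open>m > k\<close>. The condition \<open>s \<le> N\<close> is where
      \<open>m \<le> l + k + 1\<close> enters.\<close>
    define N where "N = 2 * l + 1"
    define s where "s = 2 * (m - k) - 1" \<comment> \<open>truncated: no pendant edge if \<open>m = k\<close>\<close>
    define e where "e = k - l"
    have sN: "s \<le> N" using mixed by (auto simp: N_def s_def)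
    \<comment> \<open>The graph has \<open>2 * m\<close> vertices if \<open>m > k\<close> and
      \<open>2 * m + 1\<close> if \<open>m = k\<close>, so no even cover exceeds
      \<open>2 * m\<close>.\<close>
    have W: "N + s + 2 * e \<le> n" "N + s + 2 * e \<le> 2 * m + 1"
      using mixed by (auto simp: N_def s_def e_def)
    interpret looped_graph "sun N s e" by (rule looped_graph_sun)
    have "r ! i = 1 \<longleftrightarrow> (\<exists>I. coverable I \<and> card I = i)" if i: "1 \<le> i" "i \<le> n" for i
    proof (cases "even i")
      case True
      then obtain j where j: "i = 2 * j" by (elim evenE)
      have "r ! i = 1 \<longleftrightarrow> j \<le> m" using mixed j i(2) by (metis not_le zero_neq_one)
      also have "\<dots> \<longleftrightarrow> (\<exists>I. coverable I \<and> card I = i)"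
      proof
        assume "j \<le> m"
        have "s + 2 * ((N - s) div 2) \<le> N" using sN by presburger
        moreover have "m \<le> s + (N - s) div 2 + e"
          using mixed unfolding N_def s_def e_def by (cases "m = k") auto
        ultimately show "\<exists>I. coverable I \<and> card I = i"
          using sun_coverable_even[of s "(N - s) div 2" N j e] \<open>j \<le> m\<close> j by simp
      next
        assume "\<exists>I. coverable I \<and> card I = i"
        then show "j \<le> m" using sun_coverable_card[OF sN] W(2) j by fastforce
      qed
      finally show ?thesis .
    next
      case False
      then obtain j where j: "i = 2 * j + 1" by (elim oddE)
      have "r ! i = 1 \<longleftrightarrow> l \<le> j \<and> j \<le> k" using mixed j i(2) by (metis not_le zero_neq_one)
      also have "\<dots> \<longleftrightarrow> (\<exists>I. coverable I \<and> card I = i)"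
      proof
        assume "l \<le> j \<and> j \<le> k"
        then have "i = N + 2 * (j - l)" "j - l \<le> e" using j by (auto simp: N_def e_def)
        then show "\<exists>I. coverable I \<and> card I = i"
          using sun_coverable_odd[of N "j - l" e s] by (simp add: N_def)
      next
        assume "\<exists>I. coverable I \<and> card I = i"
        then obtain I where I: "coverable I" "card I = i" by blast
        have "N \<le> i" "i \<le> N + 2 * e"
          using sun_odd_coverable(2,3)[OF sN I(1)] I(2) False by auto
        then show "l \<le> j \<and> j \<le> k" using mixed j by (auto simp: N_def e_def)
      qed
      finally show ?thesis .
    qed
    moreover have "i < n \<and> j < n" if "sun N s e i j" for i j
      using sun_bound[OF sN that] sun_bound[OF sN E_sym[OF that]] W(1) by simp
    moreover have "r ! 0 = 1" using mixed by (metis le0 mult_0_right)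
    \<comment> \<open>Only vertex 0 can carry a loop, and \<open>2 \<le> n\<close> provides vertex
      1.\<close>
    moreover have "\<exists>i<n. \<not> sun N s e i i"
      using n sun_loop[OF sN, of e 1] by (intro exI[of _ 1]) auto
    ultimately have "realizes (sun N s e) n r"
      unfolding realizes_def using n looped_graph_axioms by (intro conjI allI impI iffI) auto
    then show ?thesis by (intro exI[of _ "sun N s e"])
  next
    fix m assume bip: "?bipartite m"
    \<comment> \<open>With \<open>N = 0\<close> only \<open>m\<close> disjoint edges are left, and
      an odd cover would require \<open>N \<ge> 1\<close>.\<close>
    interpret looped_graph "sun 0 0 m" by (rule looped_graph_sun)
    have "r ! i = 1 \<longleftrightarrow> (\<exists>I. coverable I \<and> card I = i)" if i: "1 \<le> i" "i \<le> n" for i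
    proof (cases "even i")
      case True
      then obtain j where j: "i = 2 * j" by (elim evenE)
      have "r ! i = 1 \<longleftrightarrow> i \<le> 2 * m" using bip True i(2) by (metis not_le zero_neq_one)
      also have "\<dots> \<longleftrightarrow> (\<exists>I. coverable I \<and> card I = i)"
        using sun_coverable_even[of 0 0 0 j m] sun_coverable_card[of 0 0 m] j by fastforce
      finally show ?thesis .
    next
      case False
      then have "r ! i = 0" using bip i by blast
      moreover have "\<not> (\<exists>I. coverable I \<and> card I = i)"
        using sun_odd_coverable(1)[of 0 0 m] False by auto
      ultimately show ?thesis by simp
    qed
    moreover have "i < n \<and> j < n" if "sun 0 0 m i j" for i j
      using sun_bound[OF _ that] sun_bound[OF _ E_sym[OF that]] bip by auto
    moreover have "\<exists>i<n. \<not> sun 0 0 m i i"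
      using n sun_loop[of 0 0 m 0] by (intro exI[of _ 0]) auto
    ultimately have "realizes (sun 0 0 m) n r"
      unfolding realizes_def using n bip looped_graph_axioms by (intro conjI allI impI iffI) auto
    then show ?thesis by (intro exI[of _ "sun 0 0 m"])
  qed
  show ?thesis
    unfolding ppr_sequence_realizable_iff[OF length_r binary_r]
  proof (rule iffI)
    assume "\<exists>E. realizes E n r"
    then show "?full \<or> (\<exists>l k m. ?mixed l k m) \<or> (\<exists>m. ?bipartite m)"
      by (elim exE) (rule forward)
  qed (rule backward)
qed

end
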